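(* Let $\mathcal Q$ be a logic on a Hilbert space $\mathcal H$. For any $u,v\in\mathbf R^{(\mathcal Q)}$ and $\psi\in\mathcal H$, the following are equivalent: (i) $\psi\in\mathrm{ran}\,[\![u=v]\!]$; (ii) $u(\check x)\psi=v(\check x)\psi$ for every $x\in\mathbf Q$; (iii) $u(\check x)v(\check y)\psi=v(\check x\wedge\check y)\psi$ for all $x,y\in\mathbf Q$, where $\check x\wedge\check y$ denotes $\check z$ with $z=\min\{x,y\}$; (iv) $\langle u(\check x)\psi,v(\check y)\psi\rangle=\|v(\check x\wedge\check y)\psi\|^2$ for all $x,y\in\mathbf Q$.
   Context: $\mathcal Q(\mathcal H)$ is the lattice of orthogonal projections on $\mathcal H$ (order by inclusion of ranges, $\wedge,\vee$ and arbitrary $\bigwedge,\bigvee$ via intersection / closed span of union of ranges, $P^\perp=1-P$). $\mathcal A^!=\{P\in\mathcal Q(\mathcal H):PQ=QP\ \forall Q\in\mathcal A\}$; a logic is $\mathcal Q\subseteq\mathcal Q(\mathcal H)$ with $\mathcal Q=\mathcal Q^{!!}$. $P\Rightarrow Q=P^\perp\vee(P\wedge Q)$, $P\Leftrightarrow Q=(P\Rightarrow Q)\wedge(Q\Rightarrow P)$. $V^{(\mathcal Q)}=\bigcup_\alpha V^{(\mathcal Q)}_\alpha$, $V^{(\mathcal Q)}_\alpha$ the set of functions $u$ with values in $\mathcal Q$ and $\mathrm{dom}(u)\subseteq\bigcup_{\beta<\alpha}V^{(\mathcal Q)}_\beta$. Truth values: $[\![u=v]\!]=\bigwedge_{u'\in\mathrm{dom}(u)}(u(u')\Rightarrow[\![u'\in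 v]\!])\wedge\bigwedge_{v'\in\mathrm{dom}(v)}(v(v')\Rightarrow[\![v'\in u]\!])$, $[\![u\in v]\!]=\bigvee_{v'\in\mathrm{dom}(v)}(v(v')\wedge[\![u=v']\!])$, $[\![\neg\phi]\!]=[\![\phi]\!]^\perp$, connectives by lattice operations, $[\![(\forall x\in u)\phi]\!]=\bigwedge_{u'\in\mathrm{dom}(u)}(u(u')\Rightarrow[\![\phi(u')]\!])$, $[\![(\exists x\in u)\phi]\!]=\bigvee_{u'\in\mathrm{dom}(u)}(u(u')\wedge[\![\phi(u')]\!])$. For a set $v$, $\check v=\{(\check w,1):w\in v\}$; $\mathbf Q$ is the rationals. $\mathbf R(x)$ is $x\subseteq\check{\mathbf Q}\wedge\exists y\in\check{\mathbf Q}(y\in x)\wedge\exists y\in\check{\mathbf Q}(y\notin x)\wedge\forall y\in\check{\mathbf Q}(y\in x\Leftrightarrow\forall z\in\check{\mathbf Q}(y<z\Rightarrow z\in x))$ ($x\subseteq y$ abbreviates $\forall z\in x(z\in y)$, $<$ the order of rationals); $\mathbf R^{(\mathcal Q)}=\{u\in V^{(\mathcal Q)}:\mathrm{dom}(u)=\{\check r:r\in\mathbf Q\},\ [\![\mathbf R(u)]\!]=1\}$. *)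

theory Defs
  imports "HOL-Analysis.Analysis" "HOL-Library.Multiset" "HOL-Library.Equipollence"
begin

unbundle lattice_syntax

section \<open>Complex Hilbert spaces\<close>

class complex_inner = real_normed_vector +
  fixes scaleC :: "complex \<Rightarrow> 'a \<Rightarrow> 'a"
    and cinner :: "'a \<Rightarrow> 'a \<Rightarrow> complex"
  assumes scaleC_add_right: "scaleC a (x + y) = scaleC a x + scaleC a y"
    and scaleC_add_left: "scaleC (a + b) x = scaleC a x + scaleC b x"
    and scaleC_scaleC: "scaleC a (scaleC b x) = scaleC (a * b) x"
    and scaleC_one: "scaleC 1 x = x"
    and scaleC_of_real: "scaleC (complex_of_real r) x = r *\<^sub>R x"
    and cinner_commute: "cinner x y = cnj (cinner y x)"
    and cinner_add_right: "cinner x (y + z) = cinner x y + cinner x z"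
    and cinner_scaleC_right: "cinner x (scaleC a y) = a * cinner x y"
    and cinner_self: "cinner x x = complex_of_real ((norm x)\<^sup>2)"

class complex_hilbert_space = complex_inner + complete_space

interpretation complex_vector: vector_space "scaleC :: complex \<Rightarrow> 'a \<Rightarrow> 'a::complex_inner"
  by unfold_locales
    (simp_all add: scaleC_add_right scaleC_add_left scaleC_scaleC scaleC_one)


section \<open>The lattice of orthogonal projections\<close>

typedef (overloaded) 'a projection =
  "{P :: 'a::complex_hilbert_space \<Rightarrow> 'a.
      bounded_linear P \<and> (\<forall>c x. P (scaleC c x) = scaleC c (P x)) \<and>
      P \<circ> P = P \<and> (\<forall>x y. cinner (P x) y = cinner x (P y))}"
  morphisms proj_fun Abs_projection
  by (rule exI[of _ "\<lambda>x. x"]) (simp add: comp_def)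

setup_lifting type_definition_projection

definition proj_range :: "'a::complex_hilbert_space projection \<Rightarrow> 'a set" where
  "proj_range P = range (proj_fun P)"

text \<open>An orthogonal projection is determined by its range, and every closed complex subspace
  is the range of one; \<open>proj_onto\<close> is only applied to closed complex subspaces.\<close>

definition proj_onto :: "'a::complex_hilbert_space set \<Rightarrow> 'a projection" where
  "proj_onto M = (THE P. proj_range P = M)"

text \<open>\<open>- P\<close> is the orthocomplement \<open>1 - P\<close>; \<open>\<top>\<close> is the identity operator.\<close>

instantiation projection :: (complex_hilbert_space) "{ord, inf, sup, Inf, Sup, top, bot, uminus}"
begin

definition less_eq_projection :: "'a projection \<Rightarrow> 'a projection \<Rightarrow> bool" where
  "P \<le> Q \<longleftrightarrow> proj_range P \<subseteq> proj_range Q"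

definition less_projection :: "'a projection \<Rightarrow> 'a projection \<Rightarrow> bool" where
  "P < Q \<longleftrightarrow> proj_range P \<subset> proj_range Q"

definition inf_projection :: "'a projection \<Rightarrow> 'a projection \<Rightarrow> 'a projection" where
  "P \<sqinter> Q = proj_onto (proj_range P \<inter> proj_range Q)"

definition sup_projection :: "'a projection \<Rightarrow> 'a projection \<Rightarrow> 'a projection" where
  "P \<squnion> Q = proj_onto (closure (complex_vector.span (proj_range P \<union> proj_range Q)))"

definition Inf_projection :: "'a projection set \<Rightarrow> 'a projection" where
  "\<Sqinter>S = proj_onto (\<Inter>P\<in>S. proj_range P)"

definition Sup_projection :: "'a projection set \<Rightarrow> 'a projection" where
  "\<Squnion>S = proj_onto (closure (complex_vector.span (\<Union>P\<in>S. proj_range P)))"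

lift_definition top_projection :: "'a projection" is "\<lambda>x. x"
  by (simp add: comp_def)

lift_definition bot_projection :: "'a projection" is "\<lambda>x. 0"
proof -
  have "cinner x 0 = 0" for x :: 'a
    using cinner_add_right[of x 0 0] by simp
  moreover from this have "cinner 0 x = 0" for x :: 'a
    using cinner_commute[of 0 x] by simp
  ultimately show "bounded_linear (\<lambda>x::'a. 0) \<and> (\<forall>c x. 0 = scaleC c (0::'a)) \<and>
      (\<lambda>x::'a. 0::'a) \<circ> (\<lambda>x. 0) = (\<lambda>x. 0) \<and> (\<forall>x y. cinner (0::'a) y = cinner x (0::'a))"
    by (simp add: comp_def bounded_linear_zero)
qed

lift_definition uminus_projection :: "'a projection \<Rightarrow> 'a projection" is "\<lambda>P x. x - P x"
proof -
  fix P :: "'a \<Rightarrow> 'a"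
  assume P: "bounded_linear P \<and> (\<forall>c x. P (scaleC c x) = scaleC c (P x)) \<and>
      P \<circ> P = P \<and> (\<forall>x y. cinner (P x) y = cinner x (P y))"
  then interpret P: bounded_linear P by blast
  have diff_right: "cinner x (y - z) = cinner x y - cinner x z" for x y z :: 'a
    using cinner_add_right[of x "y - z" z] by (simp add: algebra_simps)
  have diff_left: "cinner (x - y) z = cinner x z - cinner y z" for x y z :: 'a
    using diff_right[of z x y] by (metis cinner_commute complex_cnj_diff)
  have idem: "P (P x) = P x" for x
    using P by (metis comp_apply)
  show "bounded_linear (\<lambda>x. x - P x) \<and>
      (\<forall>c x. scaleC c x - P (scaleC c x) = scaleC c (x - P x)) \<and>
      (\<lambda>x. x - P x) \<circ> (\<lambda>x. x - P x) = (\<lambda>x. x - P x) \<and>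
      (\<forall>x y. cinner (x - P x) y = cinner x (y - P y))"
    using P
    by (auto simp: comp_def P.diff idem diff_right diff_left complex_vector.scale_right_diff_distrib
        intro!: bounded_linear_sub bounded_linear_ident)
qed

instance ..

end

definition commutant :: "'a::complex_hilbert_space projection set \<Rightarrow> 'a projection set" where
  "commutant A = {P. \<forall>Q\<in>A. proj_fun P \<circ> proj_fun Q = proj_fun Q \<circ> proj_fun P}"

definition quantum_logic :: "'a::complex_hilbert_space projection set \<Rightarrow> bool" where
  "quantum_logic Q \<longleftrightarrow> commutant (commutant Q) = Q"

definition proj_imp :: "'a::complex_hilbert_space projection \<Rightarrow> 'a projection \<Rightarrow> 'a projection"
    (infixr \<open>\<Rrightarrow>\<close> 60) where
  "P \<Rrightarrow> Q = - P \<squnion> (P \<sqinter> Q)"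

definition proj_iff :: "'a::complex_hilbert_space projection \<Rightarrow> 'a projection \<Rightarrow> 'a projection"
    (infix \<open>\<lless>\<ggreater>\<close> 60) where
  "P \<lless>\<ggreater> Q = (P \<Rrightarrow> Q) \<sqinter> (Q \<Rrightarrow> P)"


section \<open>Sets and quantum sets\<close>

text \<open>HOL has no type of all sets. The universe of quantum sets is rendered by those that are
  hereditarily of cardinality at most \<open>max(\<aleph>\<^sub>0, |'k|)\<close>, where the type \<open>'k\<close> is an arbitrary
  parameter. A quantum set is given by its graph, the set of pairs \<open>(x, u(x))\<close> with \<open>x\<close> in its
  domain. So the type \<open>('q, 'k) qset\<close> has to be in bijection with the small subsets of
  \<open>('q, 'k) qset \<times> 'q\<close>, and its elements have to be well-founded; both are proved below for the
  following construction: trees enumerating small sets of labelled trees, where hereditarily a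
  single enumeration is chosen for each set.\<close>

abbreviation small :: "'k itself \<Rightarrow> 'a set \<Rightarrow> bool" where
  "small K A \<equiv> A \<lesssim> (UNIV :: ('k + nat) set)"

datatype ('q, 'k) tree = Tree "'k + nat \<Rightarrow> (('q, 'k) tree \<times> 'q) option"

definition enum_of :: "'a set \<Rightarrow> 'k + nat \<Rightarrow> 'a option" where
  "enum_of A = (SOME g. Map.ran g = A)"

inductive canonical :: "('q, 'k) tree \<Rightarrow> bool" where
  "(\<And>t q. (t, q) \<in> Map.ran f \<Longrightarrow> canonical t) \<Longrightarrow> f = enum_of (Map.ran f) \<Longrightarrow>
     canonical (Tree f)"

lemma small_ran: "small TYPE('k) (Map.ran f)" for f :: "'k + nat \<Rightarrow> 'a option"
proof -
  have "Map.ran f \<subseteq> (\<lambda>i. the (f i)) ` UNIV"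
  proof
    fix x assume "x \<in> Map.ran f"
    then obtain i where "f i = Some x"
      by (auto simp: Map.ran_def)
    hence "x = the (f i)" by simp
    thus "x \<in> (\<lambda>i. the (f i)) ` UNIV" by (rule image_eqI) simp
  qed
  thus ?thesis by (rule subset_image_lepoll)
qed

lemma ran_enum_of:
  assumes "small TYPE('k) A"
  shows "Map.ran (enum_of A :: 'k + nat \<Rightarrow> 'a option) = A"
proof -
  obtain h :: "'k + nat \<Rightarrow> 'a" where h: "A \<subseteq> range h"
    using assms unfolding lepoll_iff by blast
  have "Map.ran (\<lambda>i. if h i \<in> A then Some (h i) else None) = A"
    using h by (auto simp: Map.ran_def)
  hence "\<exists>g :: 'k + nat \<Rightarrow> 'a option. Map.ran g = A"
    by blast
  thus ?thesis
    unfolding enum_of_def by (rule someI_ex)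
qed

lemma canonical_enum_of:
  assumes "small TYPE('k) A" "\<And>t q. (t, q) \<in> A \<Longrightarrow> canonical t"
  shows "canonical (Tree (enum_of A) :: ('q, 'k) tree)"
  using assms by (intro canonical.intros) (auto simp: ran_enum_of)

typedef ('q, 'k) qset = "{t :: ('q, 'k) tree. canonical t}"
  morphisms tree_of Abs_qset
proof -
  have "canonical (Tree (enum_of {}) :: ('q, 'k) tree)"
    by (rule canonical_enum_of) auto
  thus ?thesis by blast
qed

definition graph :: "('q, 'k) qset \<Rightarrow> (('q, 'k) qset \<times> 'q) set" where
  "graph u = (case tree_of u of Tree f \<Rightarrow> map_prod Abs_qset id ` Map.ran f)"

text \<open>\<open>QSet S\<close> is the quantum set with graph \<open>S\<close>; it is meaningful only for small \<open>S\<close>. All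
  uses below are at countable sets, or at images of domains of quantum sets.\<close>

definition QSet :: "(('q, 'k) qset \<times> 'q) set \<Rightarrow> ('q, 'k) qset" where
  "QSet S = Abs_qset (Tree (enum_of (map_prod tree_of id ` S)))"

lemma small_graph: "small TYPE('k) (graph u)" for u :: "('q, 'k) qset"
  using small_ran image_lepoll lepoll_trans
  unfolding graph_def by (cases "tree_of u") (auto, blast)

lemma graph_QSet:
  fixes S :: "(('q, 'k) qset \<times> 'q) set"
  assumes "small TYPE('k) S"
  shows "graph (QSet S) = S"
proof -
  let ?T = "map_prod tree_of id ` S"
  have small: "small TYPE('k) ?T"
    using assms image_lepoll lepoll_trans by blast
  have "canonical t" if "(t, q) \<in> ?T" for t q
    using that tree_of by auto
  with small have "canonical (Tree (enum_of ?T) :: ('q, 'k) tree)"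
    by (rule canonical_enum_of)
  hence "tree_of (QSet S) = Tree (enum_of ?T)"
    unfolding QSet_def by (simp add: Abs_qset_inverse)
  thus ?thesis
    using small by (simp add: graph_def ran_enum_of image_image tree_of_inverse map_prod_def
        case_prod_beta)
qed

lemma QSet_graph: "QSet (graph u) = u"
proof -
  obtain f where f: "tree_of u = Tree f"
    by (cases "tree_of u")
  have "canonical (Tree f)"
    using tree_of[of u] f by simp
  hence sub: "\<And>t q. (t, q) \<in> Map.ran f \<Longrightarrow> canonical t" and "f = enum_of (Map.ran f)"
    by (auto elim: canonical.cases)
  moreover have "map_prod tree_of id ` graph u = Map.ran f"
    using sub by (force simp: graph_def f Abs_qset_inverse image_iff)
  ultimately have "QSet (graph u) = Abs_qset (tree_of u)"
    unfolding QSet_def f by simp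
  thus ?thesis by (simp add: tree_of_inverse)
qed

definition qdom :: "('q, 'k) qset \<Rightarrow> ('q, 'k) qset set" where
  "qdom u = fst ` graph u"

definition qapp :: "('q, 'k) qset \<Rightarrow> ('q, 'k) qset \<Rightarrow> 'q" where
  "qapp u x = (THE p. (x, p) \<in> graph u)"

lemma qset_induct [case_names step]:
  assumes step: "\<And>u :: ('q, 'k) qset. (\<And>x. x \<in> qdom u \<Longrightarrow> P x) \<Longrightarrow> P u"
  shows "P u"
proof -
  have "P (Abs_qset t)" if "canonical t" for t :: "('q, 'k) tree"
    using that
  proof induction
    case (1 f)
    have "tree_of (Abs_qset (Tree f)) = Tree f"
      using 1 by (simp add: Abs_qset_inverse canonical.intros)
    hence "qdom (Abs_qset (Tree f)) = Abs_qset ` fst ` Map.ran f"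
      by (simp add: qdom_def graph_def image_image)
    hence "P x" if "x \<in> qdom (Abs_qset (Tree f))" for x
      using that 1 by auto
    thus ?case by (rule step)
  qed
  from this[of "tree_of u"] show ?thesis
    using tree_of[of u] by (simp add: tree_of_inverse)
qed

lemma wf_qdom: "wf {(x, u :: ('q, 'k) qset). x \<in> qdom u}"
proof (rule wfUNIVI)
  fix P :: "('q, 'k) qset \<Rightarrow> bool" and u
  assume "\<forall>u. (\<forall>x. (x, u) \<in> {(x, u). x \<in> qdom u} \<longrightarrow> P x) \<longrightarrow> P u"
  thus "P u"
    by (induction u rule: qset_induct) blast
qed

text \<open>An ordinary set is a quantum set with trivial labels; its elements are given by \<open>qdom\<close>.\<close>

type_synonym 'k hset = "(unit, 'k) qset"

definition hset_of :: "'k hset set \<Rightarrow> 'k hset" where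
  "hset_of A = QSet (A \<times> {()})"

definition hpair :: "'k hset \<Rightarrow> 'k hset \<Rightarrow> 'k hset" where
  "hpair a b = hset_of {hset_of {a}, hset_of {a, b}}"

text \<open>The class \<open>V\<^sup>(\<^sup>Q\<^sup>)\<close>. Being generated along the ordinals, the union of the \<open>V\<^sup>(\<^sup>Q\<^sup>)\<^sub>\<alpha>\<close> is the
  least class containing every \<open>Q\<close>-valued function whose domain is included in it.\<close>

inductive_set universe :: "'q set \<Rightarrow> ('q, 'k) qset set" for Q where
  "single_valued (graph u) \<Longrightarrow> snd ` graph u \<subseteq> Q \<Longrightarrow>
     (\<And>x. x \<in> qdom u \<Longrightarrow> x \<in> universe Q) \<Longrightarrow> u \<in> universe Q"

function check :: "'k hset \<Rightarrow> ('q::top, 'k) qset" where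
  "check a = QSet ((\<lambda>w. (check w, \<top>)) ` qdom a)"
  by pat_completeness auto
termination
  by (relation "{(x, u). x \<in> qdom u}") (rule wf_qdom, simp)

declare check.simps [simp del]


section \<open>Truth values\<close>

function (sequential) qeq ::
    "('a::complex_hilbert_space projection, 'k) qset \<Rightarrow> ('a projection, 'k) qset \<Rightarrow> 'a projection"
  and qmem ::
    "('a projection, 'k) qset \<Rightarrow> ('a projection, 'k) qset \<Rightarrow> 'a projection" where
  "qeq u v = (\<Sqinter>x\<in>qdom u. qapp u x \<Rrightarrow> qmem x v) \<sqinter> (\<Sqinter>y\<in>qdom v. qapp v y \<Rrightarrow> qmem y u)"
| "qmem u v = (\<Squnion>y\<in>qdom v. qapp v y \<sqinter> qeq u y)"
  by pat_completeness auto
termination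
proof
  let ?r = "{(x, u :: ('a projection, 'k) qset). x \<in> qdom u}"
  let ?R = "inv_image (mult ?r) (case_sum (\<lambda>(u, v). {#u, v#}) (\<lambda>(u, v). {#u, v#}))"
  have mult: "({#x, v#}, {#u, v#}) \<in> mult ?r" "({#v, x#}, {#v, u#}) \<in> mult ?r"
    "({#x, v#}, {#v, u#}) \<in> mult ?r"
    if "x \<in> qdom u" for x u v :: "('a projection, 'k) qset"
    using one_step_implies_mult[of "{#u#}" "{#x#}" ?r "{#v#}"] that
    by (simp_all add: add_mset_commute)
  show "wf ?R" by (intro wf_inv_image wf_mult wf_qdom)
  show "(Inr (x, v), Inl (u, v)) \<in> ?R" if "x \<in> qdom u" for x u v :: "('a projection, 'k) qset"
    using mult(1)[OF that] by simp
  show "(Inr (y, u), Inl (u, v)) \<in> ?R" if "y \<in> qdom v" for y u v :: "('a projection, 'k) qset"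
    using mult(3)[OF that] by simp
  show "(Inl (u, y), Inr (u, v)) \<in> ?R" if "y \<in> qdom v" for y u v :: "('a projection, 'k) qset"
    using mult(2)[OF that] by simp
qed

declare qeq.simps [simp del] qmem.simps [simp del]

text \<open>Bounded quantifiers; the remaining connectives are the operations on projections.\<close>

definition qall :: "('a::complex_hilbert_space projection, 'k) qset \<Rightarrow>
    (('a projection, 'k) qset \<Rightarrow> 'a projection) \<Rightarrow> 'a projection" where
  "qall u \<phi> = (\<Sqinter>x\<in>qdom u. qapp u x \<Rrightarrow> \<phi> x)"

definition qex :: "('a::complex_hilbert_space projection, 'k) qset \<Rightarrow>
    (('a projection, 'k) qset \<Rightarrow> 'a projection) \<Rightarrow> 'a projection" where
  "qex u \<phi> = (\<Squnion>x\<in>qdom u. qapp u x \<sqinter> \<phi> x)"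


section \<open>Rationals and Dedekind reals\<close>

text \<open>\<open>c :: rat \<Rightarrow> 'k hset\<close> is an injective coding of the rationals as sets; the construction of
  the rationals in set theory is left open.\<close>

definition rat_set :: "(rat \<Rightarrow> 'k hset) \<Rightarrow> 'k hset" where
  "rat_set c = hset_of (range c)"

definition rat_less_set :: "(rat \<Rightarrow> 'k hset) \<Rightarrow> 'k hset" where
  "rat_less_set c = hset_of {hpair (c r) (c s) | r s. r < s}"

text \<open>The truth values of \<open>a = {y, z}\<close> and \<open>p = {{y}, {y, z}}\<close>, as bounded formulas.\<close>

definition qis_upair :: "('a::complex_hilbert_space projection, 'k) qset \<Rightarrow>
    ('a projection, 'k) qset \<Rightarrow> ('a projection, 'k) qset \<Rightarrow> 'a projection" where
  "qis_upair a y z = qmem y a \<sqinter> qmem z a \<sqinter> qall a (\<lambda>w. qeq w y \<squnion> qeq w z)"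

definition qis_pair :: "('a::complex_hilbert_space projection, 'k) qset \<Rightarrow>
    ('a projection, 'k) qset \<Rightarrow> ('a projection, 'k) qset \<Rightarrow> 'a projection" where
  "qis_pair p y z =
     qex p (\<lambda>a. qex p (\<lambda>b.
       qis_upair a y y \<sqinter> qis_upair b y z \<sqinter> qall p (\<lambda>w. qeq w a \<squnion> qeq w b)))"

text \<open>\<open>y < z\<close> says that the ordered pair of \<open>y\<close> and \<open>z\<close> belongs to the order relation of
  the rationals.\<close>

definition qless :: "(rat \<Rightarrow> 'k hset) \<Rightarrow> ('a::complex_hilbert_space projection, 'k) qset \<Rightarrow>
    ('a projection, 'k) qset \<Rightarrow> 'a projection" where
  "qless c y z = qex (check (rat_less_set c)) (\<lambda>p. qis_pair p y z)"

definition qis_real ::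
    "(rat \<Rightarrow> 'k hset) \<Rightarrow> ('a::complex_hilbert_space projection, 'k) qset \<Rightarrow> 'a projection" where
  "qis_real c x =
     (let rats = check (rat_set c) in
        qall x (\<lambda>z. qmem z rats) \<sqinter>
        qex rats (\<lambda>y. qmem y x) \<sqinter>
        qex rats (\<lambda>y. - qmem y x) \<sqinter>
        qall rats (\<lambda>y. qmem y x \<lless>\<ggreater> qall rats (\<lambda>z. qless c y z \<Rrightarrow> qmem z x)))"

definition qreals :: "(rat \<Rightarrow> 'k hset) \<Rightarrow> 'a::complex_hilbert_space projection set \<Rightarrow>
    ('a projection, 'k) qset set" where
  "qreals c Q =
     {u \<in> universe Q. qdom u = {check (c r) | r. True} \<and> qis_real c u = \<top>}"

end

theory Submission
  imports Defs
begin

text \<open>Ordinary sets enter the truth values only through \<open>\<top>\<close> and \<open>\<bottom>\<close>, so \<open>[[r \<in> u]] = u(r)\<close> and a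
  quantum real is an increasing family \<open>u(r)\<close> of projections with supremum \<open>\<top>\<close>. A vector lies in
  the range of \<open>P \<Rightarrow> Q\<close> iff \<open>P\<close> maps it into the range of \<open>Q\<close>, and hence in the range of
  \<open>P \<Leftrightarrow> Q\<close> iff \<open>P\<close> and \<open>Q\<close> agree on it; this is the equivalence of (i) and (ii). Monotonicity
  gives (iii) from (ii), and (iv) follows from (iii) because projections are self-adjoint. Given (iv),
  letting \<open>y\<close> tend to infinity yields \<open>\<parallel>u(x)\<psi>\<parallel>\<^sup>2 = \<parallel>v(x)\<psi>\<parallel>\<^sup>2\<close>, and the choice \<open>y = x\<close> then gives
  \<open>\<parallel>u(x)\<psi> - v(x)\<psi>\<parallel>\<^sup>2 = 0\<close>.\<close>

section \<open>Orthogonal projections onto closed subspaces\<close>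

lemma cinner_add_left: "cinner (x + y) z = cinner x z + cinner y z"
  using cinner_add_right[of z x y] by (metis cinner_commute complex_cnj_add)

lemma cinner_scaleC_left: "cinner (scaleC a x) y = cnj a * cinner x y"
  using cinner_scaleC_right[of y a x] by (metis cinner_commute complex_cnj_mult)

lemma cinner_diff_right: "cinner x (y - z) = cinner x y - cinner x z"
  using cinner_add_right[of x "y - z" z] by (simp add: algebra_simps)

lemma cinner_diff_left: "cinner (x - y) z = cinner x z - cinner y z"
  using cinner_add_left[of "x - y" y z] by (simp add: algebra_simps)

lemma cinner_zero_right [simp]: "cinner x 0 = 0"
  using cinner_diff_right[of x 0 0] by simp

lemma cinner_zero_left [simp]: "cinner 0 x = 0"
  using cinner_diff_left[of 0 0 x] by simp

lemma Re_cinner_commute: "Re (cinner x y) = Re (cinner y x)"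
  by (subst cinner_commute) simp

lemma norm_add_sq: "(norm (x + y))\<^sup>2 = (norm x)\<^sup>2 + (norm y)\<^sup>2 + 2 * Re (cinner x y)"
  for x y :: "'a::complex_inner"
proof -
  have "(norm (x + y))\<^sup>2 = Re (cinner (x + y) (x + y))"
    by (simp only: cinner_self Re_complex_of_real)
  also have "\<dots> = (norm x)\<^sup>2 + (norm y)\<^sup>2 + 2 * Re (cinner x y)"
    unfolding cinner_add_left cinner_add_right
    by (simp add: cinner_self Re_cinner_commute[of y x] del: of_real_power)
  finally show ?thesis .
qed

lemma norm_diff_sq: "(norm (x - y))\<^sup>2 = (norm x)\<^sup>2 + (norm y)\<^sup>2 - 2 * Re (cinner x y)"
  for x y :: "'a::complex_inner"
  using norm_add_sq[of "x - y" y]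
  by (simp add: cinner_diff_left cinner_self del: of_real_power)

lemma cnj_mult_self: "cnj a * a = complex_of_real ((cmod a)\<^sup>2)"
  by (metis complex_norm_square mult.commute)

lemma norm_scaleC: "norm (scaleC a x) = cmod a * norm x"
proof -
  have "complex_of_real ((norm (scaleC a x))\<^sup>2) = cnj a * a * cinner x x"
    by (simp only: cinner_self[symmetric] cinner_scaleC_left cinner_scaleC_right mult_ac)
  also have "\<dots> = complex_of_real ((cmod a * norm x)\<^sup>2)"
    unfolding cnj_mult_self by (simp add: cinner_self power_mult_distrib)
  finally have "(norm (scaleC a x))\<^sup>2 = (cmod a * norm x)\<^sup>2"
    by (simp only: of_real_eq_iff)
  thus ?thesis
    by (simp add: power2_eq_iff_nonneg)
qed

lemma bounded_linear_scaleC: "bounded_linear (\<lambda>x :: 'a::complex_inner. scaleC a x)"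
proof (rule bounded_linear_intro[where K = "cmod a"])
  show "scaleC a (r *\<^sub>R x) = r *\<^sub>R scaleC a x" for r and x :: 'a
    by (simp only: scaleC_of_real[symmetric] scaleC_scaleC mult.commute)
qed (simp_all add: scaleC_add_right norm_scaleC mult.commute)

lemma cinner_ext:
  assumes "\<And>y. cinner x y = cinner x' y"
  shows "x = x'"
proof -
  have "cinner (x - x') (x - x') = 0"
    using assms by (simp add: cinner_diff_left)
  thus ?thesis
    by (simp add: cinner_self)
qed

text \<open>Polarization expresses the real part through norms alone, so continuity of the norm
  suffices. The limit argument starting from (iv) only uses real parts.\<close>

lemma tendsto_Re_cinner:
  fixes f :: "'b \<Rightarrow> 'a::complex_inner"
  assumes "(f \<longlongrightarrow> l) F"
  shows "((\<lambda>t. Re (cinner x (f t))) \<longlongrightarrow> Re (cinner x l)) F"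
proof -
  have eq: "Re (cinner x y) = ((norm (x + y))\<^sup>2 - (norm x)\<^sup>2 - (norm y)\<^sup>2) / 2" for y
    by (simp add: norm_add_sq)
  show ?thesis
    unfolding eq by (intro tendsto_intros assms) simp
qed

text \<open>Termwise sums and multiples of approximating sequences converge. Joins are defined by
  closed spans, and \<open>proj_onto\<close> is meaningful there only if these are complex
  subspaces.\<close>

lemma closure_csubspace:
  assumes "complex_vector.subspace (S :: 'a::complex_inner set)"
  shows "complex_vector.subspace (closure S)"
proof -
  have "x + y \<in> closure S" if x: "x \<in> closure S" and y: "y \<in> closure S" for x y
  proof -
    from x y obtain f g where "\<And>n. f n \<in> S" "f \<longlonglongrightarrow> x" "\<And>n. g n \<in> S" "g \<longlonglongrightarrow> y"
      unfolding closure_sequential by blast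
    hence "\<And>n. f n + g n \<in> S" "(\<lambda>n. f n + g n) \<longlonglongrightarrow> x + y"
      using assms by (auto intro: tendsto_add complex_vector.subspace_add)
    thus ?thesis
      unfolding closure_sequential by (intro exI[of _ "\<lambda>n. f n + g n"]) simp
  qed
  moreover have "scaleC a x \<in> closure S" if x: "x \<in> closure S" for a x
  proof -
    from x obtain f where "\<And>n. f n \<in> S" "f \<longlonglongrightarrow> x"
      unfolding closure_sequential by blast
    hence "\<And>n. scaleC a (f n) \<in> S" "(\<lambda>n. scaleC a (f n)) \<longlonglongrightarrow> scaleC a x"
      using assms bounded_linear.tendsto[OF bounded_linear_scaleC]
      by (auto intro: complex_vector.subspace_scale)
    thus ?thesis
      unfolding closure_sequential by (intro exI[of _ "\<lambda>n. scaleC a (f n)"]) simp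
  qed
  moreover have "0 \<in> closure S"
    using assms closure_subset complex_vector.subspace_0 by blast
  ultimately show ?thesis
    by (simp add: complex_vector.subspace_def)
qed

text \<open>The parallelogram law makes a minimizing sequence Cauchy; completeness gives a limit,
  and closedness keeps it in \<open>M\<close>.\<close>

lemma exists_nearest_point:
  fixes M :: "'a::complex_hilbert_space set"
  assumes sub: "complex_vector.subspace M" and closed: "closed M"
  shows "\<exists>p\<in>M. \<forall>m\<in>M. norm (x - p) \<le> norm (x - m)"
proof -
  let ?D = "(\<lambda>m. norm (x - m)) ` M"
  define d where "d = Inf ?D"
  have ne: "?D \<noteq> {}"
    using sub complex_vector.subspace_0 by blast
  have bdd: "bdd_below ?D"
    by (rule bdd_belowI[of _ 0]) auto
  have lower: "d \<le> norm (x - m)" if "m \<in> M" for m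
    unfolding d_def using that bdd by (intro cInf_lower) auto
  have d0: "0 \<le> d"
    unfolding d_def using ne by (intro cInf_greatest) auto
  have "\<exists>m\<in>M. norm (x - m) < d + 1 / real (Suc n)" for n
    using cInf_lessD[OF ne, of "d + 1 / real (Suc n)"] by (auto simp: d_def)
  then obtain f where f: "\<And>n. f n \<in> M" and fd: "\<And>n. norm (x - f n) < d + 1 / real (Suc n)"
    by metis
  have lim_d: "(\<lambda>n. norm (x - f n)) \<longlonglongrightarrow> d"
  proof (rule tendsto_sandwich)
    show "(\<lambda>n. d) \<longlonglongrightarrow> d" by simp
    show "(\<lambda>n. d + 1 / real (Suc n)) \<longlonglongrightarrow> d"
      using LIMSEQ_inverse_real_of_nat_add[of d] by (simp add: inverse_eq_divide)
  qed (intro always_eventually allI less_imp_le[OF fd] lower f)+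
  \<comment> \<open>The midpoint of \<open>f m\<close> and \<open>f n\<close> lies in
    \<open>M\<close>, so the two error vectors have a sum of norm at least \<open>2 * d\<close>; the
    parallelogram law then bounds their difference.\<close>
  have para: "(norm (f m - f n))\<^sup>2 \<le> 2 * (norm (x - f m))\<^sup>2 + 2 * (norm (x - f n))\<^sup>2 - 4 * d\<^sup>2"
    for m n
  proof -
    let ?a = "x - f m" and ?b = "x - f n"
    have "(1/2) *\<^sub>R (f m + f n) \<in> M"
      unfolding scaleC_of_real[symmetric]
      by (intro complex_vector.subspace_scale complex_vector.subspace_add sub f)
    hence "d \<le> norm (x - (1/2) *\<^sub>R (f m + f n))"
      by (rule lower)
    also have "x - (1/2) *\<^sub>R (f m + f n) = (1/2) *\<^sub>R (?a + ?b)"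
      by (simp add: algebra_simps scaleR_2[symmetric])
    finally have "2 * d \<le> norm (?a + ?b)"
      by simp
    hence "(2 * d)\<^sup>2 \<le> (norm (?a + ?b))\<^sup>2"
      using d0 by (intro power_mono) auto
    moreover have "(norm (?a + ?b))\<^sup>2 + (norm (?b - ?a))\<^sup>2 = 2 * (norm ?a)\<^sup>2 + 2 * (norm ?b)\<^sup>2"
      by (simp only: norm_add_sq norm_diff_sq Re_cinner_commute[of ?b ?a]) simp
    moreover have "?b - ?a = f m - f n"
      by simp
    ultimately show ?thesis
      by (simp add: power_mult_distrib)
  qed
  have "Cauchy f"
  proof (rule metric_CauchyI)
    fix e :: real assume "0 < e"
    have "(\<lambda>n. (norm (x - f n))\<^sup>2) \<longlonglongrightarrow> d\<^sup>2"
      by (intro tendsto_intros lim_d)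
    \<comment> \<open>A quarter of the squared tolerance suffices: \<open>para\<close> doubles two
      such errors and subtracts \<open>4 * d\<^sup>2\<close>, which leaves
      \<open>e\<^sup>2\<close>.\<close>
    moreover have "d\<^sup>2 < d\<^sup>2 + e\<^sup>2 / 4"
      using \<open>0 < e\<close> by simp
    ultimately have "\<forall>\<^sub>F n in sequentially. (norm (x - f n))\<^sup>2 < d\<^sup>2 + e\<^sup>2 / 4"
      by (rule order_tendstoD(2))
    then obtain N where N: "\<And>n. n \<ge> N \<Longrightarrow> (norm (x - f n))\<^sup>2 < d\<^sup>2 + e\<^sup>2 / 4"
      by (auto simp: eventually_sequentially)
    have "dist (f m) (f n) < e" if "m \<ge> N" "n \<ge> N" for m n
    proof -
      have "(norm (f m - f n))\<^sup>2 < e\<^sup>2"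
        using para[of m n] N[OF that(1)] N[OF that(2)] by linarith
      thus ?thesis
        unfolding dist_norm using \<open>0 < e\<close> by (simp add: power_less_imp_less_base)
    qed
    thus "\<exists>N. \<forall>m\<ge>N. \<forall>n\<ge>N. dist (f m) (f n) < e"
      by blast
  qed
  hence "convergent f"
    by (simp add: Cauchy_convergent_iff)
  then obtain p where p: "f \<longlonglongrightarrow> p"
    unfolding convergent_def by blast
  have "p \<in> M"
    using closed_sequentially[OF closed f p] .
  moreover have "(\<lambda>n. norm (x - f n)) \<longlonglongrightarrow> norm (x - p)"
    by (intro tendsto_intros p)
  hence "norm (x - p) = d"
    using lim_d LIMSEQ_unique by blast
  ultimately show ?thesis
    using lower by blast
qed

text \<open>The nearest point works: if the residual had a component along some \<open>m\<close>,
  moving the point along \<open>m\<close> would bring it closer to \<open>x\<close>.\<close>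

lemma exists_orthogonal_decomposition:
  fixes M :: "'a::complex_hilbert_space set"
  assumes sub: "complex_vector.subspace M" and closed: "closed M"
  shows "\<exists>p\<in>M. \<forall>m\<in>M. cinner m (x - p) = 0"
proof -
  obtain p where p: "p \<in> M" and near: "\<And>m. m \<in> M \<Longrightarrow> norm (x - p) \<le> norm (x - m)"
    using exists_nearest_point[OF assms] by blast
  have "cinner m (x - p) = 0" if m: "m \<in> M" for m
  proof (cases "m = 0")
    case False
    let ?z = "x - p"
    define a where "a = cinner m ?z"
    \<comment> \<open>The coefficient of the residual along \<open>m\<close>. With it, the cross
      term and the squared norm of \<open>scaleC t m\<close> are the same number, and minimality
      puts twice that number below itself.\<close>
    define t where "t = a / complex_of_real ((norm m)\<^sup>2)"
    have "p + scaleC t m \<in> M"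
      by (intro complex_vector.subspace_add complex_vector.subspace_scale sub p m)
    from near[OF this] have "(norm ?z)\<^sup>2 \<le> (norm (?z - scaleC t m))\<^sup>2"
      by (intro power_mono) (simp_all add: algebra_simps)
    hence "2 * Re (cinner (scaleC t m) ?z) \<le> (norm (scaleC t m))\<^sup>2"
      by (simp add: norm_diff_sq Re_cinner_commute[of ?z])
    moreover have "Re (cinner (scaleC t m) ?z) = (cmod a)\<^sup>2 / (norm m)\<^sup>2"
    proof -
      have "cinner (scaleC t m) ?z = complex_of_real ((cmod a)\<^sup>2 / (norm m)\<^sup>2)"
        using cnj_mult_self[of a] by (simp add: cinner_scaleC_left t_def a_def[symmetric])
      thus ?thesis
        by (simp only: Re_complex_of_real)
    qed
    moreover have "(norm (scaleC t m))\<^sup>2 = (cmod a)\<^sup>2 / (norm m)\<^sup>2"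
    proof -
      have "norm (scaleC t m) = cmod a / norm m"
        using False by (simp add: norm_scaleC t_def norm_divide norm_mult power2_eq_square)
      thus ?thesis
        by (simp add: power_divide)
    qed
    ultimately have "(cmod a)\<^sup>2 / (norm m)\<^sup>2 \<le> 0"
      by simp
    with False show ?thesis
      by (simp add: a_def divide_le_0_iff)
  qed simp
  with p show ?thesis
    by blast
qed

section \<open>Projections and their ranges\<close>

lemma bounded_linear_proj_fun: "bounded_linear (proj_fun P)"
  and proj_fun_scaleC: "proj_fun P (scaleC a x) = scaleC a (proj_fun P x)"
  and proj_fun_selfadjoint: "cinner (proj_fun P x) y = cinner x (proj_fun P y)"
  using proj_fun[of P] by simp_all

lemma proj_fun_idem [simp]: "proj_fun P (proj_fun P x) = proj_fun P x"
  using proj_fun[of P] by (simp add: fun_eq_iff)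

lemma proj_fun_add: "proj_fun P (x + y) = proj_fun P x + proj_fun P y"
  by (rule linear_add[OF bounded_linear.linear[OF bounded_linear_proj_fun]])

lemma proj_fun_diff: "proj_fun P (x - y) = proj_fun P x - proj_fun P y"
  by (rule linear_diff[OF bounded_linear.linear[OF bounded_linear_proj_fun]])

lemma proj_fun_zero [simp]: "proj_fun P 0 = 0"
  by (rule linear_0[OF bounded_linear.linear[OF bounded_linear_proj_fun]])

lemma mem_proj_range: "x \<in> proj_range P \<longleftrightarrow> proj_fun P x = x"
proof
  show "proj_fun P x = x" if "x \<in> proj_range P"
    using that by (auto simp: proj_range_def)
  show "x \<in> proj_range P" if "proj_fun P x = x"
    unfolding proj_range_def by (subst that[symmetric]) (rule rangeI)
qed

lemma proj_fun_mem [simp]: "proj_fun P x \<in> proj_range P"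
  by (simp add: proj_range_def)

lemma cinner_proj_fun_self: "cinner x (proj_fun P x) = complex_of_real ((norm (proj_fun P x))\<^sup>2)"
  by (simp only: cinner_self[symmetric] proj_fun_selfadjoint proj_fun_idem)

lemma norm_sq_proj_fun: "(norm (proj_fun P x))\<^sup>2 + (norm (x - proj_fun P x))\<^sup>2 = (norm x)\<^sup>2"
  using norm_diff_sq[of x "proj_fun P x"] by (simp add: cinner_proj_fun_self del: of_real_power)

lemma csubspace_proj_range: "complex_vector.subspace (proj_range P)"
  by (simp add: complex_vector.subspace_def mem_proj_range proj_fun_add proj_fun_scaleC)

lemma closed_proj_range: "closed (proj_range P)"
proof -
  have "closed {x. proj_fun P x = x}"
    by (intro closed_Collect_eq linear_continuous_on bounded_linear_proj_fun continuous_on_id)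
  thus ?thesis
    by (simp add: mem_proj_range[symmetric])
qed

lemma proj_fun_absorb_left:
  assumes "proj_range P \<subseteq> proj_range Q"
  shows "proj_fun Q (proj_fun P x) = proj_fun P x"
  using assms proj_fun_mem mem_proj_range by blast

text \<open>The adjoint of \<open>proj_fun_absorb_left\<close>.\<close>

lemma proj_fun_absorb_right:
  assumes "proj_range P \<subseteq> proj_range Q"
  shows "proj_fun P (proj_fun Q x) = proj_fun P x"
  by (rule cinner_ext) (simp add: proj_fun_selfadjoint proj_fun_absorb_left[OF assms])

text \<open>The product of \<open>P\<close> and \<open>Q\<close> equals one factor by left
  absorption and the other by right absorption. Identities between projections thus become set
  equalities of ranges.\<close>

lemma projection_eqI:
  assumes "proj_range P = proj_range Q"
  shows "P = Q"
proof -
  have "proj_fun P x = proj_fun Q x" for x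
    using proj_fun_absorb_left[of Q P x] proj_fun_absorb_right[of P Q x] assms by simp
  thus ?thesis
    by (simp add: proj_fun_inject[symmetric] fun_eq_iff)
qed

lemma projection_eq_iff: "P = Q \<longleftrightarrow> proj_range P = proj_range Q"
  using projection_eqI by blast

text \<open>Orthogonal decompositions are unique, so the component in \<open>M\<close> depends
  linearly on the vector; orthogonality gives self-adjointness, and Pythagoras gives the norm bound
  1.\<close>

lemma exists_projection_onto:
  fixes M :: "'a::complex_hilbert_space set"
  assumes sub: "complex_vector.subspace M" and closed: "closed M"
  shows "\<exists>P. proj_range P = M"
proof -
  obtain p where p: "\<And>x. p x \<in> M" and orth: "\<And>x m. m \<in> M \<Longrightarrow> cinner m (x - p x) = 0"
    using exists_orthogonal_decomposition[OF assms] by metis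
  \<comment> \<open>Two candidates differ by an element of \<open>M\<close> orthogonal to itself.
    Additivity, homogeneity and the fixing of \<open>M\<close> then only require exhibiting a
    candidate.\<close>
  have unique: "p x = q" if "q \<in> M" and q: "\<And>m. m \<in> M \<Longrightarrow> cinner m (x - q) = 0" for x q
  proof -
    have mem: "p x - q \<in> M"
      by (intro complex_vector.subspace_diff sub p that)
    have "cinner (p x - q) ((x - q) - (x - p x)) = 0"
      unfolding cinner_diff_right[of _ "x - q"] using orth[OF mem] q[OF mem] by simp
    thus ?thesis
      by (simp add: cinner_self)
  qed
  have self: "p x = x" if "x \<in> M" for x
    using that by (intro unique) simp_all
  have add: "p (x + y) = p x + p y" for x y
  proof (rule unique)
    fix m assume "m \<in> M"
    hence "cinner m ((x - p x) + (y - p y)) = 0"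
      unfolding cinner_add_right by (simp add: orth)
    thus "cinner m (x + y - (p x + p y)) = 0"
      by (simp add: algebra_simps)
  qed (intro complex_vector.subspace_add sub p)
  have scale: "p (scaleC a x) = scaleC a (p x)" for a x
  proof (rule unique)
    fix m assume "m \<in> M"
    hence "cinner m (scaleC a (x - p x)) = 0"
      unfolding cinner_scaleC_right by (simp add: orth)
    thus "cinner m (scaleC a x - scaleC a (p x)) = 0"
      by (simp add: complex_vector.scale_right_diff_distrib)
  qed (intro complex_vector.subspace_scale sub p)
  have orth': "cinner (p x) y = cinner (p x) (p y)" for x y
    using orth[OF p, of x y] by (simp add: cinner_diff_right)
  have selfadj: "cinner (p x) y = cinner x (p y)" for x y
    using orth'[of x y] orth'[of y x] by (metis cinner_commute)
  have "norm (p x) \<le> norm x" for x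
  proof -
    have "cinner x (p x) = complex_of_real ((norm (p x))\<^sup>2)"
      using orth'[of x x] selfadj[of x x] by (simp only: cinner_self)
    hence "(norm (p x))\<^sup>2 + (norm (x - p x))\<^sup>2 = (norm x)\<^sup>2"
      using norm_diff_sq[of x "p x"] by (simp del: of_real_power)
    hence "(norm (p x))\<^sup>2 \<le> (norm x)\<^sup>2"
      using zero_le_power2[of "norm (x - p x)"] by linarith
    thus ?thesis
      by (rule power2_le_imp_le) simp
  qed
  hence "bounded_linear p"
    \<comment> \<open>Real homogeneity is the complex one at real scalars.\<close>
    using scale[of "complex_of_real _"]
    by (intro bounded_linear_intro[where K = 1]) (simp_all add: add scaleC_of_real)
  hence "proj_fun (Abs_projection p) = p"
    using scale selfadj self p by (intro Abs_projection_inverse) (simp add: fun_eq_iff)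
  hence "proj_range (Abs_projection p) = M"
    using p self by (auto simp: proj_range_def) (metis rangeI)
  thus ?thesis
    by blast
qed

text \<open>Existence and uniqueness justify the definite description in
  \<open>proj_onto\<close>.\<close>

lemma proj_range_proj_onto:
  assumes "complex_vector.subspace M" and "closed M"
  shows "proj_range (proj_onto M) = M"
proof -
  have "\<exists>!P. proj_range P = M"
    using exists_projection_onto[OF assms] projection_eqI by blast
  thus ?thesis
    unfolding proj_onto_def by (rule theI')
qed

section \<open>Lattice operations and implication computed on ranges\<close>

lemma proj_range_inf [simp]: "proj_range (P \<sqinter> Q) = proj_range P \<inter> proj_range Q"
  unfolding inf_projection_def
  by (intro proj_range_proj_onto complex_vector.subspace_inter csubspace_proj_range
      closed_Int closed_proj_range)

lemma proj_range_Inf [simp]: "proj_range (\<Sqinter>S) = (\<Inter>P\<in>S. proj_range P)"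
  unfolding Inf_projection_def
  by (intro proj_range_proj_onto complex_vector.subspace_Int csubspace_proj_range
      closed_INT ballI closed_proj_range)

lemma proj_range_sup:
  "proj_range (P \<squnion> Q) = closure (complex_vector.span (proj_range P \<union> proj_range Q))"
  unfolding sup_projection_def
  by (intro proj_range_proj_onto closure_csubspace complex_vector.subspace_span closed_closure)

lemma proj_range_Sup:
  "proj_range (\<Squnion>S) = closure (complex_vector.span (\<Union>P\<in>S. proj_range P))"
  unfolding Sup_projection_def
  by (intro proj_range_proj_onto closure_csubspace complex_vector.subspace_span closed_closure)

lemma proj_range_top [simp]: "proj_range \<top> = UNIV"
  by (simp add: proj_range_def top_projection.rep_eq)

lemma proj_range_bot [simp]: "proj_range \<bottom> = {0}"
  by (auto simp: proj_range_def bot_projection.rep_eq)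

lemma Sup_projection_upper:
  assumes "P \<in> S"
  shows "proj_range P \<subseteq> proj_range (\<Squnion>S)"
  unfolding proj_range_Sup using assms
  by (intro order_trans[OF _ closure_subset] order_trans[OF _ complex_vector.span_superset]) auto

lemma Sup_projection_least:
  assumes "\<And>P. P \<in> S \<Longrightarrow> proj_range P \<subseteq> proj_range R"
  shows "proj_range (\<Squnion>S) \<subseteq> proj_range R"
  unfolding proj_range_Sup using assms
  by (intro closure_minimal complex_vector.span_minimal csubspace_proj_range closed_proj_range) auto

lemma sup_projection_eq_Sup: "P \<squnion> Q = \<Squnion>{P, Q}"
  for P Q :: "'a::complex_hilbert_space projection"
  by (simp add: projection_eq_iff proj_range_sup proj_range_Sup)

text \<open>The right-hand condition defines a closed subspace. It contains the range of
  \<open>- P\<close>, where \<open>P\<close> vanishes, and the range of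
  \<open>P \<sqinter> Q\<close>, which \<open>P\<close> fixes. Conversely, \<open>x\<close> splits
  into \<open>x - P x\<close> and \<open>P x\<close>, one in each of these ranges.\<close>

lemma mem_proj_imp: "x \<in> proj_range (P \<Rrightarrow> Q) \<longleftrightarrow> proj_fun P x \<in> proj_range Q"
proof
  let ?M = "{x. proj_fun P x \<in> proj_range Q}"
  assume "x \<in> proj_range (P \<Rrightarrow> Q)"
  moreover have "proj_range (P \<Rrightarrow> Q) \<subseteq> ?M"
    unfolding proj_imp_def proj_range_sup
  proof (intro closure_minimal complex_vector.span_minimal)
    show "proj_range (- P) \<union> proj_range (P \<sqinter> Q) \<subseteq> ?M"
      by (auto simp: mem_proj_range uminus_projection.rep_eq)
    show "complex_vector.subspace ?M"
      using csubspace_proj_range[of Q]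
      by (simp add: complex_vector.subspace_def proj_fun_add proj_fun_scaleC)
    have "?M = proj_fun P -` proj_range Q"
      by auto
    thus "closed ?M"
      using continuous_closed_vimage[OF closed_proj_range]
        linear_continuous_at[OF bounded_linear_proj_fun] by metis
  qed
  ultimately show "proj_fun P x \<in> proj_range Q"
    by blast
next
  assume "proj_fun P x \<in> proj_range Q"
  hence "proj_fun P x \<in> proj_range (P \<sqinter> Q)"
    by simp
  moreover have "x - proj_fun P x \<in> proj_range (- P)"
    by (simp add: proj_range_def uminus_projection.rep_eq)
  ultimately have "(x - proj_fun P x) + proj_fun P x
      \<in> complex_vector.span (proj_range (- P) \<union> proj_range (P \<sqinter> Q))"
    by (intro complex_vector.span_add complex_vector.span_base) auto
  thus "x \<in> proj_range (P \<Rrightarrow> Q)"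
    unfolding proj_imp_def proj_range_sup using closure_subset by auto
qed

text \<open>The two implications place both images of \<open>x\<close> in the range of
  \<open>P \<sqinter> Q\<close>, and by absorption both equal the image of \<open>x\<close> under
  \<open>P \<sqinter> Q\<close>.\<close>

lemma mem_proj_iff: "x \<in> proj_range (P \<lless>\<ggreater> Q) \<longleftrightarrow> proj_fun P x = proj_fun Q x"
proof
  assume "x \<in> proj_range (P \<lless>\<ggreater> Q)"
  hence *: "proj_fun P x \<in> proj_range (P \<sqinter> Q)" "proj_fun Q x \<in> proj_range (P \<sqinter> Q)"
    by (simp_all add: proj_iff_def mem_proj_imp)
  have "proj_fun P x = proj_fun (P \<sqinter> Q) x"
    using *(1) proj_fun_absorb_right[of "P \<sqinter> Q" P x] by (simp only: mem_proj_range) simp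
  moreover have "proj_fun Q x = proj_fun (P \<sqinter> Q) x"
    using *(2) proj_fun_absorb_right[of "P \<sqinter> Q" Q x] by (simp only: mem_proj_range) simp
  ultimately show "proj_fun P x = proj_fun Q x"
    by simp
next
  assume "proj_fun P x = proj_fun Q x"
  thus "x \<in> proj_range (P \<lless>\<ggreater> Q)"
    by (simp add: proj_iff_def mem_proj_imp) (metis proj_fun_mem)
qed

text \<open>Turns the cut condition in \<open>qis_real\<close> into an equation between
  projections.\<close>

lemma proj_iff_eq_top: "P \<lless>\<ggreater> Q = \<top> \<longleftrightarrow> P = Q"
  by (simp add: projection_eq_iff[of _ \<top>] set_eq_iff mem_proj_iff)
    (simp add: proj_fun_inject[symmetric] fun_eq_iff)

lemma inf_projection_eq_top: "P \<sqinter> Q = \<top> \<longleftrightarrow> P = \<top> \<and> Q = \<top>"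
  for P Q :: "'a::complex_hilbert_space projection"
  by (auto simp: projection_eq_iff)

lemma Inf_projection_eq_top: "\<Sqinter>S = \<top> \<longleftrightarrow> (\<forall>P\<in>S. P = \<top>)"
  for S :: "'a::complex_hilbert_space projection set"
  by (auto simp: projection_eq_iff)

lemma top_proj_imp [simp]: "\<top> \<Rrightarrow> Q = Q"
  by (simp add: projection_eq_iff set_eq_iff mem_proj_imp top_projection.rep_eq)

lemma bot_proj_imp [simp]: "\<bottom> \<Rrightarrow> Q = \<top>"
  using complex_vector.subspace_0[OF csubspace_proj_range]
  by (simp add: projection_eq_iff set_eq_iff mem_proj_imp bot_projection.rep_eq)

lemma top_inf_projection [simp]: "\<top> \<sqinter> Q = Q" for Q :: "'a::complex_hilbert_space projection"
  by (simp add: projection_eq_iff)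

section \<open>Absoluteness for ordinary sets\<close>

text \<open>Embeds HOL propositions as trivial projections. The rewrite rules below push meets,
  joins and implications inside, so that formulas about ordinary sets evaluate to HOL
  formulas.\<close>

definition truth :: "bool \<Rightarrow> 'a::complex_hilbert_space projection" where
  "truth b = (if b then \<top> else \<bottom>)"

lemma truth_simps [simp]: "truth True = \<top>" "truth False = \<bottom>"
  by (simp_all add: truth_def)

lemma proj_range_truth [simp]: "proj_range (truth b) = (if b then UNIV else {0})"
  by (simp add: truth_def)

lemma zero_mem_proj_range [simp]: "0 \<in> proj_range P"
  by (simp add: mem_proj_range)

lemma truth_proj_imp [simp]: "truth b \<Rrightarrow> P = (if b then P else \<top>)"
  by (simp add: truth_def)

lemma inf_truth [simp]: "truth a \<sqinter> truth b = (truth (a \<and> b) :: 'a::complex_hilbert_space projection)"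
  by (auto simp: projection_eq_iff)

lemma Inf_truth [simp]:
  "(\<Sqinter>x\<in>A. truth (P x)) = (truth (\<forall>x\<in>A. P x) :: 'a::complex_hilbert_space projection)"
  by (auto simp: projection_eq_iff split: if_splits)

lemma Sup_truth [simp]:
  "(\<Squnion>x\<in>A. truth (P x)) = (truth (\<exists>x\<in>A. P x) :: 'a::complex_hilbert_space projection)"
proof (cases "\<exists>x\<in>A. P x")
  case True
  hence "(\<top> :: 'a projection) \<in> (\<lambda>x. truth (P x)) ` A"
    by (force simp: image_iff)
  from Sup_projection_upper[OF this] True show ?thesis
    by (auto simp: projection_eq_iff)
next
  case False
  hence "proj_range (\<Squnion>x\<in>A. truth (P x) :: 'a projection) \<subseteq> proj_range \<bottom>"
    by (intro Sup_projection_least) auto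
  with False show ?thesis
    by (auto simp: projection_eq_iff)
qed

text \<open>A binary join is a join over a set of booleans, to which \<open>Sup_truth\<close>
  applies with the identity as predicate.\<close>

lemma sup_truth [simp]: "truth a \<squnion> truth b = (truth (a \<or> b) :: 'a::complex_hilbert_space projection)"
  using Sup_truth[of "\<lambda>x. x" "{a, b}"] by (simp add: sup_projection_eq_Sup)

lemma inf_projection_commute: "P \<sqinter> Q = Q \<sqinter> P" for P Q :: "'a::complex_hilbert_space projection"
  by (auto simp: projection_eq_iff)

section \<open>Ordinary sets and their names\<close>

lemma small_qdom: "small TYPE('k) (qdom u)" for u :: "('q, 'k) qset"
  unfolding qdom_def using image_lepoll small_graph lepoll_trans by blast

text \<open>The summand \<open>nat\<close> of the index type makes room for every countable set, in
  particular for the rationals and their order.\<close>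

lemma countable_imp_small:
  assumes "countable A"
  shows "small TYPE('k) A"
proof -
  have "A \<lesssim> (UNIV :: nat set)"
    using assms by (auto simp: countable_def lepoll_def)
  also have "\<dots> \<lesssim> (UNIV :: ('k + nat) set)"
    unfolding lepoll_def by (intro exI[of _ Inr]) auto
  finally show ?thesis .
qed

text \<open>Labels of type \<open>unit\<close> carry no information, so the domain determines the
  graph.\<close>

lemma hset_eqI:
  fixes a b :: "'k hset"
  assumes "qdom a = qdom b"
  shows "a = b"
proof -
  have "graph x = qdom x \<times> {()}" for x :: "'k hset"
    by (force simp: qdom_def)
  with assms show ?thesis
    by (metis QSet_graph)
qed

lemma qdom_hset_of:
  fixes A :: "'k hset set"
  assumes "countable A"
  shows "qdom (hset_of A) = A"
proof -
  have "small TYPE('k) (A \<times> {()})"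
    using assms by (intro countable_imp_small) simp
  thus ?thesis
    by (simp add: qdom_def hset_of_def graph_QSet)
qed

lemma hset_of_eq_iff:
  assumes "countable A"
  shows "a = hset_of A \<longleftrightarrow> qdom a = A"
  using qdom_hset_of[OF assms] hset_eqI by metis

lemma hset_of_eq_hset_of:
  assumes "countable A" "countable B"
  shows "hset_of A = hset_of B \<longleftrightarrow> A = B"
  by (simp add: hset_of_eq_iff qdom_hset_of assms)

lemma hpair_inject: "hpair a b = hpair a' b' \<longleftrightarrow> a = a' \<and> b = b'"
  by (auto simp: hpair_def hset_of_eq_hset_of doubleton_eq_iff)

lemma graph_check: "graph (check a :: ('q::top, 'k) qset) = (\<lambda>w. (check w, \<top>)) ` qdom a"
  by (subst check.simps, rule graph_QSet) (meson image_lepoll small_qdom lepoll_trans)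

lemma qdom_check: "qdom (check a) = check ` qdom a"
  by (simp add: qdom_def graph_check image_image)

text \<open>All labels in the graph are \<open>\<top>\<close>, so the label is unique whether or not
  \<open>check\<close> is injective.\<close>

lemma qapp_check: "w \<in> qdom a \<Longrightarrow> qapp (check a) (check w) = \<top>"
  unfolding qapp_def graph_check by (rule the_equality) auto

lemma qall_check: "qall (check a) \<phi> = (\<Sqinter>w\<in>qdom a. \<phi> (check w))"
  by (simp add: qall_def qdom_check image_image qapp_check cong: image_cong)

lemma qex_check: "qex (check a) \<phi> = (\<Squnion>w\<in>qdom a. \<phi> (check w))"
  by (simp add: qex_def qdom_check image_image qapp_check cong: image_cong)

lemma qeq_commute: "qeq u v = qeq v u"
  by (simp add: qeq.simps[of u v] qeq.simps[of v u] inf_projection_commute)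

lemma qmem_check: "qmem u (check b) = (\<Squnion>y\<in>qdom b. qeq u (check y))"
  by (simp add: qmem.simps qdom_check image_image qapp_check cong: image_cong)

text \<open>Induction along membership: both inclusions become two-valued, and extensionality
  concludes.\<close>

lemma qeq_check_check [simp]:
  "qeq (check a) (check b) = (truth (a = b) :: 'a::complex_hilbert_space projection)"
proof (induction a arbitrary: b rule: qset_induct)
  case (step a)
  have "qmem (check x) (check b) = (truth (x \<in> qdom b) :: 'a projection)" if "x \<in> qdom a" for x
    by (simp add: qmem_check step[OF that])
  moreover have "qmem (check y) (check a) = (truth (y \<in> qdom a) :: 'a projection)" for y
  proof -
    \<comment> \<open>The induction hypothesis has the element of \<open>a\<close> on the left,
      hence the symmetry of \<open>qeq\<close>.\<close>
    have "qmem (check y) (check a) = (\<Squnion>x\<in>qdom a. truth (x = y) :: 'a projection)"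
      unfolding qmem_check by (intro arg_cong[of _ _ Sup] image_cong refl)
        (simp add: qeq_commute[of "check y"] step)
    thus ?thesis
      by simp
  qed
  ultimately have "qeq (check a) (check b) =
      (truth ((\<forall>x\<in>qdom a. x \<in> qdom b) \<and> (\<forall>y\<in>qdom b. y \<in> qdom a)) :: 'a projection)"
    by (simp add: qeq.simps qdom_check image_image qapp_check cong: image_cong)
  also have "(\<forall>x\<in>qdom a. x \<in> qdom b) \<and> (\<forall>y\<in>qdom b. y \<in> qdom a) \<longleftrightarrow> a = b"
    using hset_eqI by blast
  finally show ?case .
qed

lemma qmem_check_check [simp]: "qmem (check a) (check b) = truth (a \<in> qdom b)"
  by (simp add: qmem_check)

section \<open>Ordered pairs and the order of the rationals\<close>

lemma qis_upair_check: "qis_upair (check a) (check y) (check z) = truth (a = hset_of {y, z})"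
proof -
  have "y \<in> qdom a \<and> z \<in> qdom a \<and> (\<forall>w\<in>qdom a. w = y \<or> w = z) \<longleftrightarrow> qdom a = {y, z}"
    by auto
  thus ?thesis
    by (simp add: qis_upair_def qall_check hset_of_eq_iff)
qed

lemma qis_pair_check: "qis_pair (check p) (check y) (check z) = truth (p = hpair y z)"
proof -
  have "(\<exists>a\<in>qdom p. \<exists>b\<in>qdom p. a = hset_of {y, y} \<and> b = hset_of {y, z} \<and>
      (\<forall>w\<in>qdom p. w = a \<or> w = b)) \<longleftrightarrow> qdom p = {hset_of {y}, hset_of {y, z}}"
    by auto
  thus ?thesis
    by (simp add: qis_pair_def qex_check qall_check qis_upair_check hpair_def hset_of_eq_iff)
qed

text \<open>The order relation is countable, so \<open>hset_of\<close> represents it faithfully;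
  injectivity of \<open>hpair\<close> and of \<open>c\<close> then recovers the two rationals from
  their pair.\<close>

lemma qless_check:
  assumes "inj c"
  shows "qless c (check (c r)) (check (c s)) = truth (r < s)"
proof -
  have "countable {hpair (c r) (c s) | r s. r < s}"
    by (rule countable_subset[of _ "(\<lambda>(r, s). hpair (c r) (c s)) ` UNIV"]) auto
  hence "qdom (rat_less_set c) = {hpair (c r) (c s) | r s. r < s}"
    unfolding rat_less_set_def by (rule qdom_hset_of)
  moreover have "hpair (c r) (c s) \<in> {hpair (c r) (c s) | r s. r < s} \<longleftrightarrow> r < s"
    using assms by (auto simp: hpair_inject inj_eq)
  ultimately show ?thesis
    by (simp only: qless_def qex_check qis_pair_check Sup_truth) simp
qed

section \<open>Dedekind reals as increasing families of projections\<close>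

lemma qdom_rat_set: "qdom (rat_set c) = range c"
  unfolding rat_set_def by (rule qdom_hset_of) simp

text \<open>Names of distinct rationals are equal with value \<open>\<bottom>\<close>, so only the
  term at \<open>r\<close> of the join defining membership survives.\<close>

lemma qmem_rat:
  assumes "inj c" and "qdom u = {check (c r) | r. True}"
  shows "qmem (check (c r)) u = qapp u (check (c r))"
proof -
  let ?U = "\<lambda>s. qapp u (check (c s))"
  have "qdom u = range (\<lambda>s. check (c s))"
    using assms by auto
  hence *: "qmem (check (c r)) u = (\<Squnion>s. ?U s \<sqinter> truth (r = s))"
    using assms(1) by (simp add: qmem.simps image_image inj_eq)
  have "proj_range (\<Squnion>s. ?U s \<sqinter> truth (r = s)) \<subseteq> proj_range (?U r)"
    by (rule Sup_projection_least) (auto simp: truth_def split: if_splits)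
  \<comment> \<open>The factor \<open>truth (r = r)\<close> is kept so that the term is literally a
    member of the family.\<close>
  moreover have "?U r \<sqinter> truth (r = r) \<in> range (\<lambda>s. ?U s \<sqinter> truth (r = s))"
    by blast
  from Sup_projection_upper[OF this]
  have "proj_range (?U r) \<subseteq> proj_range (\<Squnion>s. ?U s \<sqinter> truth (r = s))"
    by simp
  ultimately show ?thesis
    by (simp add: projection_eq_iff *)
qed

text \<open>The clause that some rational belongs to \<open>u\<close> evaluates to the join of the
  family. The cut condition makes each member the meet of all later ones, hence contained in each of
  them.\<close>

lemma
  assumes c: "inj c" and u: "u \<in> qreals c Q"
  shows qreal_mono: "r \<le> s \<Longrightarrow> proj_range (qapp u (check (c r))) \<subseteq> proj_range (qapp u (check (c s)))"
    and qreal_Sup: "(\<Squnion>r. qapp u (check (c r))) = \<top>"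
proof -
  let ?U = "\<lambda>s. qapp u (check (c s))"
  have dom: "qdom u = {check (c r) | r. True}" and real: "qis_real c u = \<top>"
    using u by (auto simp: qreals_def)
  note mem = qmem_rat[OF c dom]
  show "(\<Squnion>r. ?U r) = \<top>"
    using real by (simp add: qis_real_def Let_def inf_projection_eq_top qex_check qdom_rat_set
        image_image mem)
  \<comment> \<open>used as a rewrite rule, this equation loops\<close>
  have "\<forall>r. ?U r = (\<Sqinter>s. truth (r < s) \<Rrightarrow> ?U s)"
    using real by (simp (no_asm_use) add: qis_real_def Let_def inf_projection_eq_top qall_check
        qdom_rat_set image_image mem qless_check[OF c] Inf_projection_eq_top proj_iff_eq_top
        del: truth_proj_imp) (elim conjE)
  hence eq: "?U r = (\<Sqinter>s. truth (r < s) \<Rrightarrow> ?U s)" for r ..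
  have "proj_range (?U r) \<subseteq> proj_range (truth (r < s) \<Rrightarrow> ?U s)" for r s
    by (subst eq[of r]) auto
  \<comment> \<open>The cut condition only compares with strictly larger rationals, so equality is a
    separate case.\<close>
  from this[of r s] show "proj_range (?U r) \<subseteq> proj_range (?U s)" if "r \<le> s"
    using that by (cases "r = s") auto
qed

text \<open>By \<open>qmem_rat\<close>, the two meets in \<open>qeq\<close> supply, rational by
  rational, the two halves of \<open>\<lless>\<ggreater>\<close>.\<close>

lemma mem_qeq_rats:
  assumes "inj c" and "qdom u = {check (c r) | r. True}" and "qdom v = {check (c r) | r. True}"
  shows "\<psi> \<in> proj_range (qeq u v) \<longleftrightarrow>
    (\<forall>r. proj_fun (qapp u (check (c r))) \<psi> = proj_fun (qapp v (check (c r))) \<psi>)"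
proof -
  have "qdom u = range (\<lambda>r. check (c r))" "qdom v = range (\<lambda>r. check (c r))"
    using assms by auto
  hence "\<psi> \<in> proj_range (qeq u v) \<longleftrightarrow>
      (\<forall>r. \<psi> \<in> proj_range (qapp u (check (c r)) \<lless>\<ggreater> qapp v (check (c r))))"
    using qmem_rat[OF assms(1,2)] qmem_rat[OF assms(1,3)]
    by (auto simp: qeq.simps image_image proj_iff_def)
  thus ?thesis
    by (simp add: mem_proj_iff)
qed

text \<open>The ranges have a dense union. A vector \<open>y\<close> of the union close to
  \<open>\<psi>\<close> is fixed by all later projections, whose complements do not increase the
  distance from \<open>y\<close> to \<open>\<psi>\<close>.\<close>

lemma proj_fun_tendsto_Sup:
  fixes V :: "'i::linorder \<Rightarrow> 'a::complex_hilbert_space projection"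
  assumes mono: "\<And>r s. r \<le> s \<Longrightarrow> proj_range (V r) \<subseteq> proj_range (V s)"
    and Sup: "(\<Squnion>r. V r) = \<top>"
  shows "((\<lambda>r. proj_fun (V r) \<psi>) \<longlongrightarrow> \<psi>) at_top"
proof (rule tendstoI)
  let ?S = "\<Union>r. proj_range (V r)"
  fix e :: real assume "0 < e"
  \<comment> \<open>Since the family is increasing, any two vectors share a range; the union is thus
    its own span and the join is merely its closure.\<close>
  have "complex_vector.subspace ?S"
    unfolding complex_vector.subspace_def
  proof (intro conjI ballI allI)
    fix x y assume "x \<in> ?S" "y \<in> ?S"
    then obtain r s where "x \<in> proj_range (V r)" "y \<in> proj_range (V s)"
      by blast
    hence "x \<in> proj_range (V (max r s))" "y \<in> proj_range (V (max r s))"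
      using mono[of r "max r s"] mono[of s "max r s"] by auto
    hence "x + y \<in> proj_range (V (max r s))"
      by (intro complex_vector.subspace_add csubspace_proj_range)
    thus "x + y \<in> ?S"
      by blast
  next
    fix a x assume "x \<in> ?S"
    thus "scaleC a x \<in> ?S"
      using complex_vector.subspace_scale[OF csubspace_proj_range] by blast
  qed simp
  hence "closure ?S = UNIV"
    using arg_cong[OF Sup, of proj_range]
    by (simp add: proj_range_Sup complex_vector.span_eq_iff[THEN iffD2])
  hence "\<exists>y\<in>?S. dist y \<psi> < e"
    using \<open>0 < e\<close> closure_approachable[of \<psi> ?S] by blast
  then obtain y where "y \<in> ?S" "dist y \<psi> < e" ..
  then obtain s where y: "y \<in> proj_range (V s)"
    by blast
  have "dist (proj_fun (V r) \<psi>) \<psi> < e" if "s \<le> r" for r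
  proof -
    let ?P = "proj_fun (V r)"
    have "?P y = y"
      using y mono[OF that] by (auto simp: mem_proj_range[symmetric])
    hence eq: "\<psi> - ?P \<psi> = (\<psi> - y) - ?P (\<psi> - y)"
      by (simp add: proj_fun_diff)
    have "(norm (\<psi> - ?P \<psi>))\<^sup>2 \<le> (norm (\<psi> - y))\<^sup>2"
      unfolding eq using norm_sq_proj_fun[of "V r" "\<psi> - y"]
        zero_le_power2[of "norm (?P (\<psi> - y))"] by linarith
    hence "norm (\<psi> - ?P \<psi>) \<le> norm (\<psi> - y)"
      by (rule power2_le_imp_le) simp
    also have "\<dots> < e"
      using \<open>dist y \<psi> < e\<close> by (simp add: dist_norm norm_minus_commute)
    finally show ?thesis
      by (simp add: dist_norm norm_minus_commute)
  qed
  thus "\<forall>\<^sub>F r in at_top. dist (proj_fun (V r) \<psi>) \<psi> < e"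
    by (rule eventually_mono[OF eventually_ge_at_top])
qed

theorem theorem5p6:
  fixes Q :: "'a::complex_hilbert_space projection set"
    and c :: "rat \<Rightarrow> 'k hset"
    and u v :: "('a projection, 'k) qset"
    and \<psi> :: 'a
  assumes "inj c" and "quantum_logic Q" and "u \<in> qreals c Q" and "v \<in> qreals c Q"
  shows "(\<psi> \<in> proj_range (qeq u v) \<longleftrightarrow>
      (\<forall>x. proj_fun (qapp u (check (c x))) \<psi> = proj_fun (qapp v (check (c x))) \<psi>)) \<and>
    (\<psi> \<in> proj_range (qeq u v) \<longleftrightarrow>
      (\<forall>x y. proj_fun (qapp u (check (c x))) (proj_fun (qapp v (check (c y))) \<psi>) =
        proj_fun (qapp v (check (c (min x y)))) \<psi>)) \<and>
    (\<psi> \<in> proj_range (qeq u v) \<longleftrightarrow>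
      (\<forall>x y. cinner (proj_fun (qapp u (check (c x))) \<psi>) (proj_fun (qapp v (check (c y))) \<psi>) =
        complex_of_real ((norm (proj_fun (qapp v (check (c (min x y)))) \<psi>))\<^sup>2)))"
proof -
  define U where "U x = proj_fun (qapp u (check (c x)))" for x
  define V where "V x = proj_fun (qapp v (check (c x)))" for x
  have i: "\<psi> \<in> proj_range (qeq u v) \<longleftrightarrow> (\<forall>x. U x \<psi> = V x \<psi>)"
    unfolding U_def V_def using assms by (intro mem_qeq_rats) (auto simp: qreals_def)
  \<comment> \<open>Replacing \<open>V y \<psi>\<close> by \<open>U y \<psi>\<close> leaves a
    product of two members of one increasing family, which absorbs to the smaller one.\<close>
  have ii_iii: "U x (V y \<psi>) = V (min x y) \<psi>" if eq: "\<forall>x. U x \<psi> = V x \<psi>" for x y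
  proof (cases "x \<le> y")
    case True
    hence "U x (U y \<psi>) = U x \<psi>"
      unfolding U_def by (intro proj_fun_absorb_right qreal_mono[OF assms(1,3)])
    with True eq show ?thesis
      by simp
  next
    case False
    hence "U x (U y \<psi>) = U y \<psi>"
      unfolding U_def by (intro proj_fun_absorb_left qreal_mono[OF assms(1,3)]) simp
    with False eq show ?thesis
      by simp
  qed
  have iii_iv: "cinner (U x \<psi>) (V y \<psi>) = complex_of_real ((norm (V (min x y) \<psi>))\<^sup>2)"
    if "\<forall>x y. U x (V y \<psi>) = V (min x y) \<psi>" for x y
  proof -
    have "cinner (U x \<psi>) (V y \<psi>) = cinner \<psi> (U x (V y \<psi>))"
      unfolding U_def by (rule proj_fun_selfadjoint)
    also have "\<dots> = cinner \<psi> (V (min x y) \<psi>)"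
      using that by simp
    finally show ?thesis
      by (simp only: V_def cinner_proj_fun_self)
  qed
  have iv_ii: "U x \<psi> = V x \<psi>"
    if iv: "\<forall>x y. cinner (U x \<psi>) (V y \<psi>) = complex_of_real ((norm (V (min x y) \<psi>))\<^sup>2)" for x
  proof -
    have "((\<lambda>y. V y \<psi>) \<longlongrightarrow> \<psi>) at_top"
      unfolding V_def using qreal_mono[OF assms(1,4)] qreal_Sup[OF assms(1,4)]
      by (rule proj_fun_tendsto_Sup)
    hence "((\<lambda>y. Re (cinner (U x \<psi>) (V y \<psi>))) \<longlongrightarrow> Re (cinner (U x \<psi>) \<psi>)) at_top"
      by (rule tendsto_Re_cinner)
    \<comment> \<open>From \<open>y = x\<close> on, the minimum is \<open>x\<close>, so the function
      is eventually constant.\<close>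
    moreover have "\<forall>\<^sub>F y in at_top. Re (cinner (U x \<psi>) (V y \<psi>)) = (norm (V x \<psi>))\<^sup>2"
      using eventually_ge_at_top[of x] by eventually_elim (simp add: iv min_def del: of_real_power)
    hence "((\<lambda>y. Re (cinner (U x \<psi>) (V y \<psi>))) \<longlongrightarrow> (norm (V x \<psi>))\<^sup>2) at_top"
      by (rule tendsto_eventually)
    ultimately have "Re (cinner (U x \<psi>) \<psi>) = (norm (V x \<psi>))\<^sup>2"
      by (intro tendsto_unique[OF trivial_limit_at_top_linorder])
    moreover have "Re (cinner (U x \<psi>) \<psi>) = (norm (U x \<psi>))\<^sup>2"
      unfolding U_def by (simp add: proj_fun_selfadjoint cinner_proj_fun_self del: of_real_power)
    \<comment> \<open>By (iv) at \<open>y = x\<close>, the real part of the mixed inner product is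
      the common squared norm, and the expansion of the square cancels.\<close>
    ultimately have "(norm (U x \<psi> - V x \<psi>))\<^sup>2 = 0"
      using iv by (simp add: norm_diff_sq del: of_real_power)
    thus ?thesis
      by simp
  qed
  \<comment> \<open>(ii), (iii) and (iv) imply each other in a cycle, and \<open>i\<close> ties (i)
    to (ii).\<close>
  show ?thesis
    unfolding U_def[symmetric] V_def[symmetric] i using ii_iii iii_iv iv_ii by blast
qed

end
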